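(* Let $n\ge 1$ and let $K,L\subseteq\mathbb{R}^n$ be convex bodies with $0\in\mathrm{int}\,K\cap\mathrm{int}\,L$. Then for any $p\in[1,\infty]$ $$ |(K\cap_p L)^\circ|\,|(K+_p(-L))^\circ|\leq\binom{2n}{n}\frac{\Gamma\left(1+\frac{n}{p}\right)^2}{\Gamma\left(1+\frac{2n}{p}\right)}|K^\circ|\,|L^\circ|, $$ where for $p=\infty$ one sets $\frac{n}{p}=\frac{2n}{p}=0$.
   Context: A convex body in $\mathbb{R}^n$ is a convex compact set with non-empty interior; $|\cdot|$ is Lebesgue measure; $-L=\{-y:y\in L\}$; $\Gamma$ is the Gamma function. For a convex body $K$ with $0\in\mathrm{int}\,K$, the polar body is $K^\circ=\{x\in\mathbb{R}^n:\langle x,y\rangle\le 1\ \forall y\in K\}$ and the support function is $h_K(x)=\max_{y\in K}\langle x,y\rangle$. For convex bodies $K,L$ with $0$ in their interiors, the $\ell_p$-sum $K+_pL$ is the convex body with support function $$h_{K+_pL}(x)=\left(h_K^p(x)+h_L^p(x)\right)^{1/p}\ (1\le p<\infty),\qquad h_{K+_\infty L}(x)=\max\{h_K(x),h_L(x)\},$$ and the $\ell_p$-intersection $K\cap_pL$ is the convex body with support function $$h_{K\cap_pL}(x)=\inf_{x_1+x_2=x}\left(h_K^p(x_1)+h_L^p(x_2)\right)^{1/p}\ (1\le p<\infty),\qquad h_{K\cap_\infty L}(x)=\inf_{x_1+x_2=x}\max\{h_K(x_1),h_L(x_2)\}.$$ *)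

theory Defs
  imports "HOL-Analysis.Analysis"
begin

definition convex_body :: "'a::euclidean_space set \<Rightarrow> bool" where
  "convex_body K \<longleftrightarrow> convex K \<and> compact K \<and> interior K \<noteq> {}"

definition polar_body :: "'a::euclidean_space set \<Rightarrow> 'a set" where
  "polar_body K = {x. \<forall>y\<in>K. x \<bullet> y \<le> 1}"

definition support_fun :: "'a::euclidean_space set \<Rightarrow> 'a \<Rightarrow> real" where
  "support_fun K x = (SUP y\<in>K. x \<bullet> y)"

text \<open>A convex body is determined by its support function; existence for the support functions
  used below is shown at the end of this theory.\<close>
definition body_with_support :: "('a::euclidean_space \<Rightarrow> real) \<Rightarrow> 'a set" where
  "body_with_support h = (THE M. convex_body M \<and> (\<forall>x. support_fun M x = h x))"

text \<open>Only used for nonnegative \<open>a\<close>, \<open>b\<close> and \<open>p \<in> [1, \<infinity>]\<close>, where \<open>powr\<close> agrees with the usual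
  power also at base \<open>0\<close>.\<close>
definition lp_comb :: "ereal \<Rightarrow> real \<Rightarrow> real \<Rightarrow> real" where
  "lp_comb p a b =
     (if p = \<infinity> then max a b
      else (a powr real_of_ereal p + b powr real_of_ereal p) powr (1 / real_of_ereal p))"

definition lp_sum_support :: "ereal \<Rightarrow> 'a::euclidean_space set \<Rightarrow> 'a set \<Rightarrow> 'a \<Rightarrow> real" where
  "lp_sum_support p K L x = lp_comb p (support_fun K x) (support_fun L x)"

definition lp_inter_support :: "ereal \<Rightarrow> 'a::euclidean_space set \<Rightarrow> 'a set \<Rightarrow> 'a \<Rightarrow> real" where
  "lp_inter_support p K L x =
     Inf {lp_comb p (support_fun K x1) (support_fun L x2) | x1 x2. x1 + x2 = x}"

definition lp_sum :: "ereal \<Rightarrow> 'a::euclidean_space set \<Rightarrow> 'a set \<Rightarrow> 'a set" where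
  "lp_sum p K L = body_with_support (lp_sum_support p K L)"

definition lp_inter :: "ereal \<Rightarrow> 'a::euclidean_space set \<Rightarrow> 'a set \<Rightarrow> 'a set" where
  "lp_inter p K L = body_with_support (lp_inter_support p K L)"

text \<open>The quotient \<open>m / p\<close> with the convention \<open>m / \<infinity> = 0\<close>.\<close>
definition over_exponent :: "real \<Rightarrow> ereal \<Rightarrow> real" where
  "over_exponent m p = (if p = \<infinity> then 0 else m / real_of_ereal p)"

text \<open>
  The rest of this theory shows that for \<open>p \<in> [1, \<infinity>]\<close> and convex bodies \<open>K\<close>, \<open>L\<close> with \<open>0\<close> in
  their interiors, \<open>lp_sum p K L\<close> and \<open>lp_inter p K L\<close> are convex bodies with \<open>0\<close> in their
  interiors that have the prescribed support functions.
\<close>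

lemma support_fun_upper:
  assumes "compact K" "y \<in> K"
  shows "x \<bullet> y \<le> support_fun K x"
proof -
  have "bounded ((\<lambda>y. x \<bullet> y) ` K)"
    by (intro compact_imp_bounded compact_continuous_image assms continuous_intros)
  then show ?thesis
    unfolding support_fun_def using assms(2) by (intro cSUP_upper bounded_imp_bdd_above) auto
qed

lemma support_fun_attained:
  assumes "compact K" "K \<noteq> {}"
  obtains y where "y \<in> K" "support_fun K x = x \<bullet> y"
proof -
  have "continuous_on K (\<lambda>y. x \<bullet> y)" by (intro continuous_intros)
  from continuous_attains_sup[OF assms this] obtain y where
    y: "y \<in> K" "\<forall>z\<in>K. x \<bullet> z \<le> x \<bullet> y" by blast
  have "support_fun K x = x \<bullet> y"
    unfolding support_fun_def using y by (intro cSup_eq_maximum) auto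
  with y(1) show ?thesis using that by blast
qed

lemma convex_body_subset_if_support_le:
  assumes "convex_body M" "convex_body N" "\<And>x. support_fun M x \<le> support_fun N x"
  shows "M \<subseteq> N"
proof
  fix y assume y: "y \<in> M"
  show "y \<in> N"
  proof (rule ccontr)
    assume "y \<notin> N"
    have N: "convex N" "closed N" "compact N" "N \<noteq> {}"
      using assms(2) interior_subset unfolding convex_body_def by (auto intro: compact_imp_closed)
    from separating_hyperplane_closed_point[OF N(1,2) \<open>y \<notin> N\<close>]
    obtain a b where ab: "a \<bullet> y < b" "\<forall>x\<in>N. b < a \<bullet> x" by blast
    obtain z where z: "z \<in> N" "support_fun N (-a) = (-a) \<bullet> z"
      using support_fun_attained[OF N(3,4)] by blast
    have "(-a) \<bullet> y \<le> support_fun M (-a)"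
      using y assms(1) unfolding convex_body_def by (intro support_fun_upper) auto
    also have "\<dots> \<le> (-a) \<bullet> z" using assms(3)[of "-a"] z(2) by simp
    finally show False using ab z(1) by force
  qed
qed

definition sublinear_pos :: "('a::euclidean_space \<Rightarrow> real) \<Rightarrow> bool" where
  "sublinear_pos h \<longleftrightarrow>
     (\<forall>x y. h (x + y) \<le> h x + h y) \<and> (\<forall>c x. 0 \<le> c \<longrightarrow> h (c *\<^sub>R x) = c * h x) \<and>
     (\<exists>r>0. \<forall>x. r * norm x \<le> h x)"

lemma sublinear_posD:
  assumes "sublinear_pos h"
  shows "h (x + y) \<le> h x + h y" "0 \<le> c \<Longrightarrow> h (c *\<^sub>R x) = c * h x"
    "h 0 = 0" "0 \<le> h x" "x \<noteq> 0 \<Longrightarrow> 0 < h x" "continuous_on UNIV h"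
proof -
  show a: "h (x + y) \<le> h x + h y" for x y using assms unfolding sublinear_pos_def by blast
  show b: "0 \<le> c \<Longrightarrow> h (c *\<^sub>R x) = c * h x" for x c
    using assms unfolding sublinear_pos_def by blast
  show z: "h 0 = 0" using b[of 0 0] by simp
  obtain r where r: "r > 0" "\<And>x. r * norm x \<le> h x" using assms unfolding sublinear_pos_def by blast
  show "0 \<le> h x" using r(2)[of x] r(1) by (meson mult_nonneg_nonneg norm_ge_zero order.strict_implies_order order.trans)
  show "0 < h x" if "x \<noteq> 0"
    using r(2)[of x] mult_pos_pos[OF r(1), of "norm x"] that by simp
  have "convex_on UNIV h"
  proof (rule convex_onI)
    fix t :: real and x y :: 'a assume "0 < t" "t < 1"
    then show "h ((1 - t) *\<^sub>R x + t *\<^sub>R y) \<le> (1 - t) * h x + t * h y"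
      using a[of "(1 - t) *\<^sub>R x" "t *\<^sub>R y"] by (simp add: b)
  qed auto
  then show "continuous_on UNIV h" by (intro convex_on_continuous) auto
qed

lemma sublinear_pos_support:
  assumes "convex_body K" "0 \<in> interior K"
  shows "sublinear_pos (support_fun K)"
proof -
  have K: "compact K" "K \<noteq> {}" using assms interior_subset unfolding convex_body_def by auto
  obtain e where e: "e > 0" "cball 0 e \<subseteq> K" using assms(2) mem_interior_cball by blast
  have "support_fun K (x + y) \<le> support_fun K x + support_fun K y" for x y
    by (metis K support_fun_attained support_fun_upper add_mono inner_add_left)
  moreover have "support_fun K (c *\<^sub>R x) = c * support_fun K x" if "0 \<le> c" for c x
  proof (rule antisym)
    obtain y where y: "y \<in> K" "support_fun K (c *\<^sub>R x) = (c *\<^sub>R x) \<bullet> y"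
      using support_fun_attained[OF K] by blast
    then show "support_fun K (c *\<^sub>R x) \<le> c * support_fun K x"
      using support_fun_upper[OF K(1) y(1)] that by (simp add: mult_left_mono)
    obtain y where y: "y \<in> K" "support_fun K x = x \<bullet> y"
      using support_fun_attained[OF K] by blast
    then show "c * support_fun K x \<le> support_fun K (c *\<^sub>R x)"
      using support_fun_upper[OF K(1) y(1), of "c *\<^sub>R x"] by simp
  qed
  moreover have "e * norm x \<le> support_fun K x" for x
  proof (cases "x = 0")
    case True
    moreover have "0 \<in> K" using e by auto
    ultimately show ?thesis using support_fun_upper[OF K(1), of 0 x] by simp
  next
    case False
    have "(e / norm x) *\<^sub>R x \<in> K" using e False by (auto simp: subset_iff)
    from support_fun_upper[OF K(1) this, of x] False show ?thesis
      by (simp add: dot_square_norm power2_eq_square)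
  qed
  ultimately show ?thesis unfolding sublinear_pos_def using e(1) by blast
qed

lemma sublinear_pos_upper:
  assumes "sublinear_pos h"
  obtains R where "R > 0" "\<And>x. h x \<le> R * norm x"
proof -
  have "compact (sphere (0::'a) 1)" by simp
  moreover have "continuous_on (sphere 0 1) h"
    using sublinear_posD(6)[OF assms] continuous_on_subset by blast
  ultimately have "bdd_above (h ` sphere 0 1)"
    by (intro bounded_imp_bdd_above compact_imp_bounded compact_continuous_image)
  then obtain B where "\<forall>y\<in>h ` sphere 0 1. y \<le> B" unfolding bdd_above_def by blast
  then have B: "h x \<le> B" if "norm x = 1" for x using that by simp
  have "h x \<le> max 1 B * norm x" for x
  proof (cases "x = 0")
    case True then show ?thesis using sublinear_posD(3)[OF assms] by simp
  next
    case False
    have "h x = norm x * h (sgn x)"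
      using sublinear_posD(2)[OF assms, of "norm x" "sgn x"] False by (simp add: sgn_div_norm)
    also have "\<dots> \<le> norm x * max 1 B"
      using B[of "sgn x"] False by (intro mult_left_mono) (auto simp: norm_sgn)
    finally show ?thesis by (simp add: mult.commute)
  qed
  then show ?thesis using that[of "max 1 B"] by auto
qed

lemma sublinear_pos_body:
  fixes h :: "'a::euclidean_space \<Rightarrow> real"
  assumes h: "sublinear_pos h"
  defines "M \<equiv> {y. \<forall>x. x \<bullet> y \<le> h x}"
  shows "convex_body M" "0 \<in> interior M" "support_fun M x = h x"
proof -
  note hD = sublinear_posD[OF h]
  obtain r where r: "r > 0" "\<And>x. r * norm x \<le> h x" using h unfolding sublinear_pos_def by blast
  obtain R where R: "R > 0" "\<And>x. h x \<le> R * norm x" using sublinear_pos_upper[OF h] by blast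
  have M_eq: "M = (\<Inter>x. {y. x \<bullet> y \<le> h x})" unfolding M_def by auto
  have cv: "convex M" unfolding M_eq by (intro convex_INT convex_halfspace_le)
  have cl: "closed M" unfolding M_eq by (intro closed_INT ballI closed_halfspace_le)
  have "norm y \<le> R" if "y \<in> M" for y
  proof (cases "y = 0")
    case False
    have "y \<bullet> y \<le> R * norm y" using that R(2)[of y] unfolding M_def by (force intro: order.trans)
    then show ?thesis using False by (simp add: dot_square_norm power2_eq_square)
  qed (use R in auto)
  then have "bounded M" by (auto simp: bounded_iff)
  with cl have cp: "compact M" by (simp add: compact_eq_bounded_closed)
  have "ball 0 r \<subseteq> M"
  proof
    fix y assume "y \<in> ball (0::'a) r"
    then have "norm y \<le> r" by simp
    then have "x \<bullet> y \<le> h x" for x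
      using norm_cauchy_schwarz[of x y] r(2)[of x] mult_left_mono[of "norm y" r "norm x"]
      by (simp add: mult.commute)
    then show "y \<in> M" by (simp add: M_def)
  qed
  then show z: "0 \<in> interior M" using r(1) by (meson centre_in_ball mem_interior)
  then show cb: "convex_body M" using cv cp by (auto simp: convex_body_def)
  have ne: "M \<noteq> {}" using z interior_subset by auto
  show "support_fun M x = h x"
  proof (rule antisym)
    show "support_fun M x \<le> h x"
      by (metis (mono_tags, lifting) M_def mem_Collect_eq support_fun_attained[OF cp ne])
    show "h x \<le> support_fun M x"
    proof (cases "x = 0")
      case True
      then show ?thesis using support_fun_upper[OF cp, of 0 0] z interior_subset hD(3) by auto
    next
      case False
      then have hx: "h x > 0" by (rule hD(5))
      define C where "C = {u. h u \<le> 1}"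
      have "closed C" unfolding C_def
        using hD(6) by (intro closed_Collect_le) auto
      have "convex C"
      proof (rule convexI)
        fix u v and s t :: real assume *: "u \<in> C" "v \<in> C" "0 \<le> s" "0 \<le> t" "s + t = 1"
        have "h (s *\<^sub>R u + t *\<^sub>R v) \<le> s * h u + t * h v"
          using hD(1)[of "s *\<^sub>R u" "t *\<^sub>R v"] * by (simp add: hD(2))
        also have "\<dots> \<le> s * 1 + t * 1"
          using * unfolding C_def by (intro add_mono mult_left_mono) auto
        finally show "s *\<^sub>R u + t *\<^sub>R v \<in> C" using * by (simp add: C_def)
      qed
      show ?thesis
      proof (rule field_le_mult_one_interval)
        fix t :: real assume t: "0 < t" "t < 1"
        define v where "v = (1 / (t * h x)) *\<^sub>R x"
        have "h v = 1 / t" unfolding v_def using t hx by (subst hD(2)) auto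
        then have "v \<notin> C" using t by (simp add: C_def)
        from separating_hyperplane_closed_point[OF \<open>convex C\<close> \<open>closed C\<close> this]
        obtain a b where ab: "a \<bullet> v < b" "\<forall>u\<in>C. b < a \<bullet> u" by blast
        have b: "b < 0" using ab(2)[rule_format, of 0] hD(3) by (simp add: C_def)
        define w where "w = (1 / b) *\<^sub>R a"
        have w1: "u \<bullet> w \<le> 1" if "u \<in> C" for u
          using ab(2) that b by (auto simp: w_def inner_commute field_simps intro: less_imp_le)
        have wM: "w \<in> M" unfolding M_def
        proof (safe)
          fix u show "u \<bullet> w \<le> h u"
          proof (cases "u = 0")
            case False
            then have hu: "h u > 0" by (rule hD(5))
            have "(1 / h u) *\<^sub>R u \<in> C" unfolding C_def using hu by (simp add: hD(2))
            from w1[OF this] hu show ?thesis by (simp add: field_simps)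
          qed (use hD(3) in auto)
        qed
        have "1 < v \<bullet> w" using ab(1) b by (simp add: w_def inner_commute field_simps)
        then have "t * h x < x \<bullet> w" using t hx by (simp add: v_def field_simps)
        also have "\<dots> \<le> support_fun M x" using wM by (rule support_fun_upper[OF cp])
        finally show "t * h x \<le> support_fun M x" by simp
      qed
    qed
  qed
qed

lemma body_with_support:
  assumes h: "sublinear_pos h"
  shows "convex_body (body_with_support h)" "support_fun (body_with_support h) x = h x"
    "0 \<in> interior (body_with_support h)"
proof -
  let ?M = "{y. \<forall>x. x \<bullet> y \<le> h x}"
  note M = sublinear_pos_body[OF h]
  have "body_with_support h = ?M"
    unfolding body_with_support_def
  proof (rule the_equality)
    fix N assume "convex_body N \<and> (\<forall>x. support_fun N x = h x)"
    then show "N = ?M"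
      using M by (intro antisym convex_body_subset_if_support_le) auto
  qed (use M in auto)
  then show "convex_body (body_with_support h)" "support_fun (body_with_support h) x = h x"
    "0 \<in> interior (body_with_support h)" using M by auto
qed

lemma lp_comb_basic:
  assumes p: "1 \<le> p" and ab: "0 \<le> a" "0 \<le> b"
  shows "0 \<le> lp_comb p a b" "a \<le> lp_comb p a b" "b \<le> lp_comb p a b"
    "lp_comb p a 0 = a"
    "0 \<le> c \<Longrightarrow> lp_comb p (c * a) (c * b) = c * lp_comb p a b"
    "\<lbrakk>a \<le> a'; b \<le> b'\<rbrakk> \<Longrightarrow> lp_comb p a b \<le> lp_comb p a' b'"
proof -
  show A: "0 \<le> lp_comb p a b" using ab by (auto simp: lp_comb_def)
  show "a \<le> lp_comb p a b" "b \<le> lp_comb p a b" "lp_comb p a 0 = a"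
    "0 \<le> c \<Longrightarrow> lp_comb p (c * a) (c * b) = c * lp_comb p a b"
    "\<lbrakk>a \<le> a'; b \<le> b'\<rbrakk> \<Longrightarrow> lp_comb p a b \<le> lp_comb p a' b'"
  proof -
    consider "p = \<infinity>" | q where "p = ereal q" "q \<ge> 1"
      using p by (cases p) (auto simp: one_ereal_def)
    then have "a \<le> lp_comb p a b \<and> b \<le> lp_comb p a b \<and> lp_comb p a 0 = a \<and>
      (0 \<le> c \<longrightarrow> lp_comb p (c * a) (c * b) = c * lp_comb p a b) \<and>
      (a \<le> a' \<longrightarrow> b \<le> b' \<longrightarrow> lp_comb p a b \<le> lp_comb p a' b')"
    proof cases
      case 1
      then show ?thesis using ab by (auto simp: lp_comb_def max_mult_distrib_left)
    next
      case 2
      have e: "lp_comb p u v = (u powr q + v powr q) powr (1 / q)" for u v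
        using 2 by (simp add: lp_comb_def)
      have inv: "(u powr q) powr (1 / q) = u" if "0 \<le> u" for u
        using that 2 by (simp add: powr_powr)
      have "a = (a powr q) powr (1 / q)" "b = (b powr q) powr (1 / q)" using inv ab by auto
      moreover have "(a powr q) powr (1 / q) \<le> lp_comb p a b"
        "(b powr q) powr (1 / q) \<le> lp_comb p a b"
        unfolding e using 2 by (intro powr_mono2; simp)+
      moreover have "lp_comb p a 0 = a" unfolding e using inv ab by simp
      moreover have "lp_comb p (c * a) (c * b) = c * lp_comb p a b" if "0 \<le> c"
        unfolding e using that ab inv[OF that]
        by (simp add: powr_mult flip: distrib_left)
      moreover have "lp_comb p a b \<le> lp_comb p a' b'" if "a \<le> a'" "b \<le> b'"
        unfolding e using that ab 2 by (intro powr_mono2 add_mono) auto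
      ultimately show ?thesis by argo
    qed
    then show "a \<le> lp_comb p a b" "b \<le> lp_comb p a b" "lp_comb p a 0 = a"
    "0 \<le> c \<Longrightarrow> lp_comb p (c * a) (c * b) = c * lp_comb p a b"
    "\<lbrakk>a \<le> a'; b \<le> b'\<rbrakk> \<Longrightarrow> lp_comb p a b \<le> lp_comb p a' b'" by auto
  qed
qed

lemma powr_convex_nonneg:
  assumes q: "1 \<le> q"
  shows "convex_on {0..} (\<lambda>x::real. x powr q)"
proof (rule convex_onI)
  fix t x y :: real
  assume t: "0 < t" "t < 1" and xy: "x \<in> {0..}" "y \<in> {0..}"
  have le: "(s * z) powr q \<le> s * z powr q" if "0 < s" "s < 1" "0 \<le> z" for s z :: real
  proof -
    have "s powr q \<le> s powr 1" using that q by (intro powr_mono') auto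
    then show ?thesis using that by (simp add: powr_mult mult_right_mono)
  qed
  consider "x = 0" | "y = 0" | "0 < x" "0 < y" using xy by force
  then show "((1 - t) *\<^sub>R x + t *\<^sub>R y) powr q \<le> (1 - t) * x powr q + t * y powr q"
  proof cases
    case 3
    then show ?thesis using convex_onD[OF powr_convex[OF q], of t x y] t by simp
  qed (use le[of t y] le[of "1 - t" x] t xy in auto)
qed auto

lemma lp_comb_triangle:
  assumes p: "1 \<le> p" and nn: "0 \<le> a" "0 \<le> b" "0 \<le> c" "0 \<le> d"
  shows "lp_comb p (a + c) (b + d) \<le> lp_comb p a b + lp_comb p c d"
proof -
  consider "p = \<infinity>" | q where "p = ereal q" "q \<ge> 1"
    using p by (cases p) (auto simp: one_ereal_def)
  then show ?thesis
  proof cases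
    case 1
    then show ?thesis by (auto simp: lp_comb_def)
  next
    case 2
    have e: "lp_comb p u v = (u powr q + v powr q) powr (1 / q)" for u v
      using 2 by (simp add: lp_comb_def)
    define A B where "A = lp_comb p a b" and "B = lp_comb p c d"
    have AB: "0 \<le> A" "0 \<le> B" "a \<le> A" "b \<le> A" "c \<le> B" "d \<le> B"
      unfolding A_def B_def using lp_comb_basic[OF p] nn by auto
    show ?thesis
    proof (cases "A = 0 \<or> B = 0")
      case True
      then consider "a = 0" "b = 0" | "c = 0" "d = 0" using AB nn by force
      then show ?thesis using lp_comb_basic(1)[OF p] nn by cases auto
    next
      case False
      then have P: "A > 0" "B > 0" using AB by auto
      have Aq: "a powr q + b powr q = A powr q" unfolding A_def e using 2 by (simp add: powr_powr)
      have Bq: "c powr q + d powr q = B powr q" unfolding B_def e using 2 by (simp add: powr_powr)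
      have cx: "((u + v) / (A + B)) powr q \<le> A / (A + B) * (u / A) powr q + B / (A + B) * (v / B) powr q"
        if "0 \<le> u" "0 \<le> v" for u v
      proof -
        have "convex_on {0..} (\<lambda>x::real. x powr q)" using 2 by (intro powr_convex_nonneg) auto
        from convex_onD[OF this, of "B / (A + B)" "u / A" "v / B"] P that
        have "((1 - B / (A + B)) * (u / A) + B / (A + B) * (v / B)) powr q \<le>
          (1 - B / (A + B)) * (u / A) powr q + B / (A + B) * (v / B) powr q"
          by simp
        moreover have "1 - B / (A + B) = A / (A + B)" using P by (simp add: field_simps)
        moreover have "A / (A + B) * (u / A) + B / (A + B) * (v / B) = (u + v) / (A + B)"
          using P by (simp add: add_divide_distrib)
        ultimately show ?thesis by simp
      qed
      have "((a + c) / (A + B)) powr q + ((b + d) / (A + B)) powr q \<le>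
        A / (A + B) * ((a / A) powr q + (b / A) powr q) + B / (A + B) * ((c / B) powr q + (d / B) powr q)"
        using cx[OF nn(1,3)] cx[OF nn(2,4)] by (simp add: distrib_left)
      also have "(a / A) powr q + (b / A) powr q = 1"
        using P nn Aq by (simp add: powr_divide flip: add_divide_distrib)
      also have "(c / B) powr q + (d / B) powr q = 1"
        using P nn Bq by (simp add: powr_divide flip: add_divide_distrib)
      finally have "((a + c) / (A + B)) powr q + ((b + d) / (A + B)) powr q \<le> 1"
        using P by (simp flip: add_divide_distrib)
      then have "(a + c) powr q + (b + d) powr q \<le> (A + B) powr q"
        using P nn by (simp add: powr_divide flip: add_divide_distrib)
      then have "lp_comb p (a + c) (b + d) \<le> ((A + B) powr q) powr (1 / q)"
        unfolding e using 2 by (intro powr_mono2) auto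
      also have "\<dots> = A + B" using P 2 by (simp add: powr_powr)
      finally show ?thesis by (simp add: A_def B_def)
    qed
  qed
qed

lemma sublinear_pos_lp_sum_support:
  assumes p: "1 \<le> p"
    and K: "convex_body K" "0 \<in> interior K" and L: "convex_body L" "0 \<in> interior L"
  shows "sublinear_pos (lp_sum_support p K L)"
proof -
  let ?k = "support_fun K" and ?l = "support_fun L"
  note k = sublinear_pos_support[OF K] and l = sublinear_pos_support[OF L]
  note kD = sublinear_posD[OF k] and lD = sublinear_posD[OF l]
  note N = lp_comb_basic[OF p kD(4) lD(4)]
  obtain r where r: "r > 0" "\<And>x. r * norm x \<le> ?k x" using k unfolding sublinear_pos_def by blast
  have "lp_sum_support p K L (x + y) \<le> lp_sum_support p K L x + lp_sum_support p K L y" for x y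
    unfolding lp_sum_support_def
    by (rule order.trans[OF N(6)[OF kD(1) lD(1)] lp_comb_triangle[OF p kD(4) lD(4) kD(4) lD(4)]])
  moreover have "lp_sum_support p K L (c *\<^sub>R x) = c * lp_sum_support p K L x" if "0 \<le> c" for c x
    unfolding lp_sum_support_def using that by (simp add: kD(2) lD(2) N(5))
  moreover have "r * norm x \<le> lp_sum_support p K L x" for x
    unfolding lp_sum_support_def using r(2) N(2) order.trans by blast
  ultimately show ?thesis unfolding sublinear_pos_def using r(1) by blast
qed

lemma sublinear_pos_lp_inter_support:
  fixes K L :: "'a::euclidean_space set"
  assumes p: "1 \<le> p"
    and K: "convex_body K" "0 \<in> interior K" and L: "convex_body L" "0 \<in> interior L"
  shows "sublinear_pos (lp_inter_support p K L)"
proof -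
  let ?k = "support_fun K" and ?l = "support_fun L" and ?g = "lp_inter_support p K L"
  note k = sublinear_pos_support[OF K] and l = sublinear_pos_support[OF L]
  note kD = sublinear_posD[OF k] and lD = sublinear_posD[OF l]
  note N = lp_comb_basic[OF p kD(4) lD(4)]
  define S where "S x = {lp_comb p (?k x1) (?l x2) | x1 x2. x1 + x2 = x}" for x
  have g: "?g x = Inf (S x)" for x by (simp add: lp_inter_support_def S_def)
  have ne: "S x \<noteq> {}" for x unfolding S_def using add_0_right[of x] by blast
  have bd: "bdd_below (S x)" for x unfolding S_def using N(1) by (intro bdd_belowI[of _ 0]) auto
  have up: "?g (u + v) \<le> lp_comb p (?k u) (?l v)" for u v
    unfolding g by (intro cInf_lower bd) (auto simp: S_def)
  have lo: "m \<le> ?g x" if "\<And>u v. u + v = x \<Longrightarrow> m \<le> lp_comb p (?k u) (?l v)" for m x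
    unfolding g using ne that by (intro cInf_greatest) (auto simp: S_def)
  have add: "?g (x + y) \<le> ?g x + ?g y" for x y
  proof -
    have 1: "?g (x + y) - lp_comb p (?k u) (?l v) \<le> ?g y" if "u + v = x" for u v
    proof (rule lo)
      fix u' v' assume "u' + v' = y"
      then have "?g (x + y) \<le> lp_comb p (?k (u + u')) (?l (v + v'))"
        using up[of "u + u'" "v + v'"] that by (metis add.assoc add.left_commute)
      also have "\<dots> \<le> lp_comb p (?k u) (?l v) + lp_comb p (?k u') (?l v')"
        by (rule order.trans[OF N(6)[OF kD(1) lD(1)] lp_comb_triangle[OF p kD(4) lD(4) kD(4) lD(4)]])
      finally show "?g (x + y) - lp_comb p (?k u) (?l v) \<le> lp_comb p (?k u') (?l v')" by simp
    qed
    have "?g (x + y) - ?g y \<le> ?g x" by (rule lo) (use 1 in force)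
    then show ?thesis by simp
  qed
  obtain r where r: "r > 0" "\<And>x. r * norm x \<le> ?k x" using k unfolding sublinear_pos_def by blast
  obtain s where s: "s > 0" "\<And>x. s * norm x \<le> ?l x" using l unfolding sublinear_pos_def by blast
  define t where "t = min r s / 2"
  have t: "t > 0" using r s by (simp add: t_def)
  have low: "t * norm x \<le> ?g x" for x
  proof (rule lo)
    fix u v :: 'a assume uv: "u + v = x"
    have "t * norm x \<le> t * norm u + t * norm v"
      using t norm_triangle_ineq[of u v] uv by (simp flip: distrib_left)
    also have "\<dots> \<le> r / 2 * norm u + s / 2 * norm v"
      by (intro add_mono mult_right_mono) (auto simp: t_def)
    also have "\<dots> \<le> ?k u / 2 + ?l v / 2" using r(2)[of u] s(2)[of v] by simp
    also have "\<dots> \<le> lp_comb p (?k u) (?l v)" using N(2)[of u v] N(3)[of v u] by argo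
    finally show "t * norm x \<le> lp_comb p (?k u) (?l v)" .
  qed
  have sc: "?g (c *\<^sub>R x) \<le> c * ?g x" if "0 < c" for c x
  proof -
    have "?g (c *\<^sub>R x) / c \<le> ?g x"
    proof (rule lo)
      fix u v assume "u + v = x"
      then have "?g (c *\<^sub>R x) \<le> lp_comb p (?k (c *\<^sub>R u)) (?l (c *\<^sub>R v))"
        using up[of "c *\<^sub>R u" "c *\<^sub>R v"] by (simp add: scaleR_add_right[symmetric])
      also have "\<dots> = c * lp_comb p (?k u) (?l v)" using that by (simp add: kD(2) lD(2) N(5))
      finally show "?g (c *\<^sub>R x) / c \<le> lp_comb p (?k u) (?l v)" using that by (simp add: field_simps)
    qed
    then show ?thesis using that by (simp add: field_simps)
  qed
  have "?g (c *\<^sub>R x) = c * ?g x" if "0 \<le> c" for c x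
  proof (cases "c = 0")
    case True
    have "?g 0 \<le> 0" using up[of 0 0] by (simp add: kD(3) lD(3) lp_comb_basic(4)[OF p, of 0 0])
    moreover have "0 \<le> ?g 0" using low[of 0] by simp
    ultimately show ?thesis using True by simp
  next
    case False
    then have c: "c > 0" using that by simp
    have "?g x \<le> (1 / c) * ?g (c *\<^sub>R x)" using sc[of "1 / c" "c *\<^sub>R x"] c by simp
    then have "c * ?g x \<le> ?g (c *\<^sub>R x)" using c by (simp add: field_simps)
    with sc[OF c, of x] show ?thesis by simp
  qed
  with add low t show ?thesis unfolding sublinear_pos_def by blast
qed

theorem lp_sum_props:
  assumes "1 \<le> p" "convex_body K" "0 \<in> interior K" "convex_body L" "0 \<in> interior L"
  shows "convex_body (lp_sum p K L)" "0 \<in> interior (lp_sum p K L)"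
    "support_fun (lp_sum p K L) x = lp_sum_support p K L x"
  unfolding lp_sum_def
  using body_with_support[OF sublinear_pos_lp_sum_support[OF assms]] by auto

theorem lp_inter_props:
  assumes "1 \<le> p" "convex_body K" "0 \<in> interior K" "convex_body L" "0 \<in> interior L"
  shows "convex_body (lp_inter p K L)" "0 \<in> interior (lp_inter p K L)"
    "support_fun (lp_inter p K L) x = lp_inter_support p K L x"
  unfolding lp_inter_def
  using body_with_support[OF sublinear_pos_lp_inter_support[OF assms]] by auto

end

theory Submission
  imports Defs
begin

text \<open>
  Consider \<open>W = {(x, y). h\<^sub>K(x)\<^sup>p + h\<^sub>L(y)\<^sup>p \<le> 1}\<close> in dimension \<open>2n\<close>. The polar of the
  \<open>\<ell>\<^sub>p\<close>-intersection is the image of \<open>W\<close> under \<open>(x, y) \<mapsto> x + y\<close>, and the polar of \<open>K +\<^sub>p (-L)\<close>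
  is the fibre of this map over \<open>0\<close>. By convexity the fibre over a point of gauge \<open>t\<close> contains
  a translate of the central fibre shrunk by \<open>1 - t\<close>, so integrating \<open>(1 - t)\<^sup>n\<close> over the image
  bounds the product of the two volumes by \<open>2n choose n\<close> times the volume of \<open>W\<close>. Slicing \<open>W\<close>
  over the first factor gives its volume exactly, with the Gamma quotient coming from
  \<open>a B(a, a + 1) = \<Gamma>(1 + a)\<^sup>2 / \<Gamma>(1 + 2a)\<close> at \<open>a = n / p\<close>; the same identity at \<open>a = n\<close> yields the
  binomial coefficient.
\<close>

section \<open>Beta integrals of functions whose sublevel sets have power-law measure\<close>

lemma nn_integral_powr_atLeastAtMost:
  fixes a t V :: real
  assumes "0 < a" "0 \<le> V" "0 \<le> t"
  shows "(\<integral>\<^sup>+s. ennreal (V * a * s powr (a - 1)) * indicator {0..t} s \<partial>lborel) = ennreal (V * t powr a)"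
proof -
  have "((\<lambda>s. V * a * s powr (a - 1)) has_integral V * a * (t powr (a - 1 + 1) / (a - 1 + 1))) {0..t}"
    using assms by (intro has_integral_mult_right has_integral_powr_from_0) auto
  then show ?thesis
    using assms by (subst nn_integral_has_integral_lebesgue') auto
qed

text \<open>A measure on the line that is finite on every half-line \<open>{..t}\<close> is
  determined by these values. Integrating the density from \<open>0\<close> to \<open>t\<close>
  recovers \<open>V * t powr a\<close>; for negative \<open>t\<close> both sides vanish.\<close>

lemma distr_eq_power_density:
  fixes g :: "'b \<Rightarrow> real"
  assumes g[measurable]: "g \<in> borel_measurable M" and nonneg: "\<And>x. 0 \<le> g x"
    and a: "0 < a" and V: "0 \<le> V"
    and sub: "\<And>t. 0 \<le> t \<Longrightarrow> emeasure M {x\<in>space M. g x \<le> t} = ennreal (V * t powr a)"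
  shows "distr M borel g =
    density lborel (\<lambda>s. ennreal (V * a * s powr (a - 1)) * indicator {0..} s)" (is "?M = ?N")
proof (rule measure_eqI_generator_eq)
  show "Int_stable (range atMost :: real set set)"
    by (auto simp: Int_stable_def)
  show "sets ?M = sigma_sets UNIV (range atMost)" "sets ?N = sigma_sets UNIV (range atMost)"
    by (simp_all add: borel_eq_atMost)
  show "range (\<lambda>i::nat. {..real i}) \<subseteq> range atMost" by auto
  show "(\<Union>i::nat. {..real i}) = UNIV" using real_arch_simple by blast
  have M: "emeasure ?M {..t} = emeasure M {x\<in>space M. g x \<le> t}" for t
    by (subst emeasure_distr) (auto simp: vimage_def Int_def conj_commute)
  show "emeasure ?M {..real i} \<noteq> \<infinity>" for i
    by (simp add: M sub)
  fix X :: "real set" assume "X \<in> range atMost"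
  then obtain t where X: "X = {..t}" by auto
  have N: "emeasure ?N X = (\<integral>\<^sup>+s. ennreal (V * a * s powr (a - 1)) * indicator {0..t} s \<partial>lborel)"
    unfolding X
    by (subst emeasure_density) (auto intro!: nn_integral_cong split: split_indicator)
  show "emeasure ?M X = emeasure ?N X"
  proof (cases "0 \<le> t")
    case True
    then show ?thesis
      unfolding N using a V by (simp add: X M sub nn_integral_powr_atLeastAtMost)
  next
    case False
    then have e: "{x\<in>space M. g x \<le> t} = {}" by (auto dest: order.trans[OF nonneg])
    have "{0..t} = {}" using False by simp
    then show ?thesis unfolding N by (simp only: X M e) simp
  qed
qed auto

lemma Beta_Suc_eq_Gamma:
  fixes a :: real
  assumes "0 < a"
  shows "a * Beta a (a + 1) = Gamma (1 + a) ^ 2 / Gamma (1 + 2 * a)"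
proof -
  have "Gamma (a + 1) = a * Gamma a" using assms by (intro Gamma_plus1) (auto dest: nonpos_Ints_nonpos)
  then show ?thesis
    by (simp add: Beta_def power2_eq_square add.commute mult_ac)
qed

text \<open>Pushing the measure forward along \<open>g\<close> turns the integral into
  \<open>V * a * Beta a (a + 1)\<close>. It serves twice: with \<open>a = n\<close> for the fibres
  of the sum map and with \<open>a = n / p\<close> for the slices.\<close>

lemma nn_integral_one_minus_powr:
  fixes g :: "'b \<Rightarrow> real"
  assumes g[measurable]: "g \<in> borel_measurable M" and nonneg: "\<And>x. 0 \<le> g x"
    and a: "0 < a" and V: "0 \<le> V"
    and sub: "\<And>t. 0 \<le> t \<Longrightarrow> emeasure M {x\<in>space M. g x \<le> t} = ennreal (V * t powr a)"
  shows "(\<integral>\<^sup>+x. ennreal ((1 - g x) powr a) * indicator {..1} (g x) \<partial>M) =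
    ennreal (V * (Gamma (1 + a) ^ 2 / Gamma (1 + 2 * a)))"
proof -
  \<comment> \<open>The exponent \<open>a\<close> is written as \<open>a + 1 - 1\<close> to fit the
    Beta integral with parameters \<open>a\<close> and \<open>a + 1\<close>.\<close>
  have I: "((\<lambda>s. V * a * (s powr (a - 1) * (1 - s) powr (a + 1 - 1))) has_integral
      V * a * Beta a (a + 1)) {0..1}"
    using a by (intro has_integral_mult_right has_integral_Beta_real) auto
  have "(\<integral>\<^sup>+x. ennreal ((1 - g x) powr a) * indicator {..1} (g x) \<partial>M) =
      (\<integral>\<^sup>+s. ennreal ((1 - s) powr a) * indicator {..1} s \<partial>distr M borel g)"
    by (subst nn_integral_distr) auto
  also have "\<dots> = (\<integral>\<^sup>+s. ennreal (V * a * s powr (a - 1)) * indicator {0..} s *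
      (ennreal ((1 - s) powr a) * indicator {..1} s) \<partial>lborel)"
    using assms by (subst distr_eq_power_density[OF assms]) (auto intro!: nn_integral_density)
  also have "\<dots> = (\<integral>\<^sup>+s. ennreal (V * a * (s powr (a - 1) * (1 - s) powr (a + 1 - 1))) *
      indicator {0..1} s \<partial>lborel)"
    using a V by (intro nn_integral_cong) (auto simp: ennreal_mult' mult_ac split: split_indicator)
  also have "\<dots> = ennreal (V * a * Beta a (a + 1))"
    using a V by (intro nn_integral_has_integral_lebesgue' I) auto
  finally show ?thesis
    using Beta_Suc_eq_Gamma[OF a] by (simp add: mult.assoc)
qed

section \<open>Volumes of sublevel sets, and polar bodies as sublevel sets\<close>

lemma emeasure_lborel_affine_image:
  fixes S :: "'a::euclidean_space set"
  assumes "closed S"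
  shows "emeasure lborel ((\<lambda>x. c + m *\<^sub>R x) ` S) = ennreal (\<bar>m\<bar> ^ DIM('a)) * emeasure lborel S"
proof -
  have "closed ((\<lambda>x. c + m *\<^sub>R x) ` S)"
    using closed_translation[OF closed_scaling[OF assms, of m], of c] by (simp add: image_image)
  then show ?thesis
    using emeasure_lebesgue_affine[of m c S] assms by (simp add: emeasure_completion add.commute)
qed

context
  fixes h :: "'a::euclidean_space \<Rightarrow> real"
  assumes h: "sublinear_pos h"
begin

lemma sublinear_pos_closed_sublevel: "closed {x. h x \<le> t}"
  using sublinear_posD(6)[OF h] by (intro closed_Collect_le) auto

lemma sublinear_pos_bounded_sublevel: "bounded {x. h x \<le> t}"
proof -
  obtain r where r: "r > 0" "\<And>x. r * norm x \<le> h x" using h unfolding sublinear_pos_def by blast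
  have "norm x \<le> t / r" if "h x \<le> t" for x
    using r(1) r(2)[of x] that by (simp add: field_simps)
  then show ?thesis by (auto simp: bounded_iff)
qed

lemma sublinear_pos_emeasure_unit:
  "emeasure lborel {x. h x \<le> 1} = ennreal (measure lborel {x. h x \<le> 1})"
  using emeasure_bounded_finite[OF sublinear_pos_bounded_sublevel[of 1]]
  by (intro emeasure_eq_ennreal_measure) auto

text \<open>By homogeneity the sublevel set at \<open>t > 0\<close> is the unit one dilated by
  \<open>t\<close>; at \<open>t = 0\<close> it shrinks to a point, a null set.\<close>

lemma sublinear_pos_emeasure_sublevel:
  assumes t: "0 \<le> t"
  shows "emeasure lborel {x. h x \<le> t} = ennreal (measure lborel {x. h x \<le> 1} * t ^ DIM('a))"
proof (cases "t = 0")
  case True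
  have "{x. h x \<le> 0} = {0}"
    using sublinear_posD(3,5)[OF h] by force
  then show ?thesis using True by simp
next
  case False
  then have t: "0 < t" using t by simp
  have "{x. h x \<le> t} = (\<lambda>x. 0 + t *\<^sub>R x) ` {x. h x \<le> 1}"
  proof (intro equalityI subsetI)
    fix x assume "x \<in> {x. h x \<le> t}"
    then have "h ((1 / t) *\<^sub>R x) \<le> 1" using t by (subst sublinear_posD(2)[OF h]) auto
    then show "x \<in> (\<lambda>x. 0 + t *\<^sub>R x) ` {x. h x \<le> 1}"
      using t by (intro image_eqI[of _ _ "(1 / t) *\<^sub>R x"]) auto
  qed (use t mult_left_mono[of _ 1 t] in \<open>auto simp: sublinear_posD(2)[OF h]\<close>)
  then show ?thesis
    using t by (simp add: emeasure_lborel_affine_image[OF sublinear_pos_closed_sublevel]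
        sublinear_pos_emeasure_unit ennreal_mult' mult.commute del: add_0)
qed

end

text \<open>The supremum defining \<open>support_fun\<close> is attained on a compact set, so
  bounding every inner product by \<open>1\<close> is bounding their maximum.\<close>

lemma polar_body_eq_sublevel:
  assumes "convex_body K"
  shows "polar_body K = {x. support_fun K x \<le> 1}"
proof -
  have K: "compact K" "K \<noteq> {}" using assms interior_subset by (auto simp: convex_body_def)
  have "(\<forall>y\<in>K. x \<bullet> y \<le> 1) \<longleftrightarrow> support_fun K x \<le> 1" for x
    by (metis order.trans support_fun_upper[OF K(1)] support_fun_attained[OF K])
  then show ?thesis by (simp add: polar_body_def)
qed

lemma support_fun_uminus: "support_fun (uminus ` L) x = support_fun L (- x)"
  by (simp add: support_fun_def image_image)

lemma convex_body_uminus: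
  assumes "convex_body L" "0 \<in> interior L"
  shows "convex_body (uminus ` L)" "0 \<in> interior (uminus ` L)"
  using assms unfolding convex_body_def
  by (auto simp: interior_negations convex_negations compact_negations)

section \<open>The Rogers--Shephard inequality for a section and a projection\<close>

text \<open>\<open>N\<close> abstracts \<open>lp_comb p\<close> of the two support functions to a
  gauge on the product space. Joint continuity gives measurability and closed fibres; joint
  sublinearity gives the convexity of the unit set.\<close>

locale gauge_pair =
  fixes N :: "'a::euclidean_space \<Rightarrow> 'a \<Rightarrow> real"
  assumes cont: "continuous_on UNIV (\<lambda>(x, y). N x y)"
    and subadd: "N (x + x') (y + y') \<le> N x y + N x' y'"
    and homog: "0 \<le> c \<Longrightarrow> N (c *\<^sub>R x) (c *\<^sub>R y) = c * N x y"
begin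

lemma closed_fiber: "closed {u. N u (z - u) \<le> 1}"
proof -
  have "continuous_on UNIV (\<lambda>u. (u, z - u))" by (intro continuous_intros)
  from continuous_on_compose2[OF cont this] show ?thesis
    by (intro closed_Collect_le) auto
qed

text \<open>Both sides are the volume of the unit set of \<open>N\<close> in the product:
  translating each slice by \<open>x\<close> introduces \<open>z = x + y\<close>, and Fubini swaps
  the integrals.\<close>

lemma emeasure_eq_integral_fibers:
  "(\<integral>\<^sup>+x. emeasure lborel {y. N x y \<le> 1} \<partial>lborel) =
    (\<integral>\<^sup>+z. emeasure lborel {u. N u (z - u) \<le> 1} \<partial>lborel)"
proof -
  have [measurable]: "(\<lambda>(x, y). N x y) \<in> borel_measurable (borel \<Otimes>\<^sub>M borel)"
    using borel_measurable_continuous_onI[OF cont] by (simp add: borel_prod)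
  have sl: "emeasure lborel {y. N x y \<le> 1} = (\<integral>\<^sup>+z. indicator {..1} (N x (z - x)) \<partial>lborel)" for x
  proof -
    have "emeasure lborel {y. N x y \<le> 1} = (\<integral>\<^sup>+y. indicator {y. N x y \<le> 1} y \<partial>lborel)"
      by simp
    also have "\<dots> = (\<integral>\<^sup>+y. indicator {y. N x y \<le> 1} y \<partial>distr lborel borel ((+) (- x)))"
      by (simp only: lborel_distr_plus)
    also have "\<dots> = (\<integral>\<^sup>+z. indicator {..1} (N x (z - x)) \<partial>lborel)"
      by (subst nn_integral_distr) (auto simp: indicator_def)
    finally show ?thesis .
  qed
  have "(\<integral>\<^sup>+x. emeasure lborel {y. N x y \<le> 1} \<partial>lborel) =
      (\<integral>\<^sup>+z. \<integral>\<^sup>+x. indicator {..1} (N x (z - x)) \<partial>lborel \<partial>lborel)"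
    unfolding sl by (rule lborel_pair.Fubini'[symmetric]) measurable
  also have "\<dots> = (\<integral>\<^sup>+z. \<integral>\<^sup>+x. indicator {u. N u (z - u) \<le> 1} x \<partial>lborel \<partial>lborel)"
    by (intro nn_integral_cong) (auto simp: indicator_def)
  also have "\<dots> = (\<integral>\<^sup>+z. emeasure lborel {u. N u (z - u) \<le> 1} \<partial>lborel)"
    using closed_fiber by (intro nn_integral_cong nn_integral_indicator) auto
  finally show ?thesis .
qed

text \<open>If \<open>z = u + v\<close> with \<open>N u v \<le> s\<close>, the fibre over \<open>z\<close> contains \<open>u\<close> plus the central fibre
  shrunk by the factor \<open>1 - s\<close>.\<close>
lemma fiber_ge:
  assumes "N u v \<le> s" "s \<le> 1"
  shows "ennreal ((1 - s) ^ DIM('a)) * emeasure lborel {w. N w (- w) \<le> 1} \<le>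
    emeasure lborel {w. N w (u + v - w) \<le> 1}"
proof -
  have c: "closed {w. N w (- w) \<le> 1}" using closed_fiber[of 0] by simp
  have "N (u + (1 - s) *\<^sub>R w) (u + v - (u + (1 - s) *\<^sub>R w)) \<le> 1" if "N w (- w) \<le> 1" for w
  proof -
    have "N (u + (1 - s) *\<^sub>R w) (v + (1 - s) *\<^sub>R (- w)) \<le> N u v + (1 - s) * N w (- w)"
      using subadd homog[of "1 - s" w "- w"] assms by (metis diff_ge_0_iff_ge)
    also have "\<dots> \<le> s + (1 - s) * 1"
      using assms that by (intro add_mono mult_left_mono) auto
    finally show ?thesis by simp
  qed
  then have "(\<lambda>w. u + (1 - s) *\<^sub>R w) ` {w. N w (- w) \<le> 1} \<subseteq> {w. N w (u + v - w) \<le> 1}"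
    by blast
  then have "emeasure lborel ((\<lambda>w. u + (1 - s) *\<^sub>R w) ` {w. N w (- w) \<le> 1}) \<le>
      emeasure lborel {w. N w (u + v - w) \<le> 1}"
    using closed_fiber[of "u + v"] by (intro emeasure_mono) auto
  then show ?thesis
    using assms by (simp add: emeasure_lborel_affine_image[OF c])
qed

text \<open>The gauge of the image of \<open>{(x, y). N x y \<le> 1}\<close> under addition.\<close>
definition sum_gauge :: "'a \<Rightarrow> real" where
  "sum_gauge z = Inf {N u v | u v. u + v = z}"

text \<open>The infimum in \<open>sum_gauge\<close> need not be attained, so \<open>fiber_ge\<close>
  is applied for \<open>s\<close> above it and \<open>s\<close> then decreases to it.\<close>

lemma fiber_ge_sum_gauge:
  assumes "sum_gauge z \<le> 1"
  shows "ennreal ((1 - sum_gauge z) powr DIM('a)) * emeasure lborel {w. N w (- w) \<le> 1} \<le>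
    emeasure lborel {w. N w (z - w) \<le> 1}"
proof (cases "sum_gauge z < 1")
  case True
  have ne: "{N u v | u v. u + v = z} \<noteq> {}" using add_0_right[of z] by blast
  \<comment> \<open>The limit of the first factor is positive, so the product converges in
    \<open>ennreal\<close> even if the central fibre had infinite measure.\<close>
  have "((\<lambda>s. ennreal ((1 - s) ^ DIM('a)) * emeasure lborel {w. N w (- w) \<le> 1}) \<longlongrightarrow>
      ennreal ((1 - sum_gauge z) ^ DIM('a)) * emeasure lborel {w. N w (- w) \<le> 1}) (at_right (sum_gauge z))"
    by (intro tendsto_mult_ennreal tendsto_ennrealI tendsto_intros) (use True in auto)
  moreover have "\<forall>\<^sub>F s in at_right (sum_gauge z).
      ennreal ((1 - s) ^ DIM('a)) * emeasure lborel {w. N w (- w) \<le> 1} \<le>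
      emeasure lborel {w. N w (z - w) \<le> 1}"
    using eventually_at_right_real[OF True]
  proof eventually_elim
    case (elim s)
    then have "Inf {N u v | u v. u + v = z} < s" by (simp add: sum_gauge_def)
    from cInf_lessD[OF ne this] obtain u v where "u + v = z" "N u v < s" by blast
    then show ?case using fiber_ge[of u v s] elim by simp
  qed
  ultimately have "ennreal ((1 - sum_gauge z) ^ DIM('a)) * emeasure lborel {w. N w (- w) \<le> 1} \<le>
      emeasure lborel {w. N w (z - w) \<le> 1}"
    by (intro tendsto_upperbound) auto
  then show ?thesis using True by (simp add: powr_realpow)
\<comment> \<open>What remains is \<open>sum_gauge z = 1\<close>, where \<open>0 powr n = 0\<close>
  makes the left side vanish.\<close>
qed (use assms in simp)

text \<open>Integrating the fibre bound over the image yields the product of the two volumes times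
  the Beta constant at \<open>a = n\<close>, whose reciprocal is the binomial coefficient.\<close>

theorem rogers_shephard:
  assumes sum_gauge: "sublinear_pos sum_gauge"
  shows "emeasure lborel {z. sum_gauge z \<le> 1} * emeasure lborel {w. N w (- w) \<le> 1} \<le>
    ennreal (real ((2 * DIM('a)) choose DIM('a))) *
      (\<integral>\<^sup>+x. emeasure lborel {y. N x y \<le> 1} \<partial>lborel)"
proof -
  let ?n = "real DIM('a)" and ?V = "measure lborel {z. sum_gauge z \<le> 1}"
  let ?F = "emeasure lborel {w. N w (- w) \<le> 1}" and ?b = "real ((2 * DIM('a)) choose DIM('a))"
  let ?c = "Gamma (1 + ?n) ^ 2 / Gamma (1 + 2 * ?n)"
  have [measurable]: "sum_gauge \<in> borel_measurable borel"
    using sublinear_posD(6)[OF sum_gauge] by (rule borel_measurable_continuous_onI)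
  have b: "?b * ?c = 1"
    using Gamma_fact[of "DIM('a)", where 'a=real] Gamma_fact[of "2 * DIM('a)", where 'a=real]
    by (simp add: binomial_fact power2_eq_square)
  have "ennreal (?V * ?c) * ?F =
      (\<integral>\<^sup>+z. ennreal ((1 - sum_gauge z) powr ?n) * indicator {..1} (sum_gauge z) \<partial>lborel) * ?F"
    using sublinear_posD(4)[OF sum_gauge]
    by (subst nn_integral_one_minus_powr[of _ _ _ ?V])
       (auto simp: sublinear_pos_emeasure_sublevel[OF sum_gauge] powr_realpow')
  also have "\<dots> = (\<integral>\<^sup>+z. ennreal ((1 - sum_gauge z) powr ?n) * indicator {..1} (sum_gauge z) * ?F \<partial>lborel)"
    by (rule nn_integral_multc[symmetric]) measurable
  also have "\<dots> \<le> (\<integral>\<^sup>+z. emeasure lborel {w. N w (z - w) \<le> 1} \<partial>lborel)"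
    \<comment> \<open>Outside the image the indicator kills the left integrand, so the pointwise
      bound holds everywhere.\<close>
    using fiber_ge_sum_gauge by (intro nn_integral_mono) (auto split: split_indicator)
  finally have "ennreal ?b * (ennreal (?V * ?c) * ?F) \<le>
      ennreal ?b * (\<integral>\<^sup>+x. emeasure lborel {y. N x y \<le> 1} \<partial>lborel)"
    by (simp add: emeasure_eq_integral_fibers mult_left_mono)
  moreover have "ennreal ?b * (ennreal (?V * ?c) * ?F) = ennreal (?V * (?b * ?c)) * ?F"
    by (subst mult.assoc[symmetric], subst ennreal_mult'[symmetric]) (auto simp: mult_ac)
  ultimately show ?thesis
    unfolding b using sublinear_pos_emeasure_unit[OF sum_gauge] by simp
qed

end

section \<open>The volume of the \<open>\<ell>\<^sub>p\<close>-product of two gauges\<close>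

text \<open>For a positive constant exponent \<open>powr\<close> is continuous up to base
  \<open>0\<close>.\<close>

lemma continuous_on_lp_comb:
  assumes p: "1 \<le> p" and "continuous_on S f" "continuous_on S g"
    and "\<And>x. 0 \<le> f x" "\<And>x. 0 \<le> g x"
  shows "continuous_on S (\<lambda>x. lp_comb p (f x) (g x))"
proof (cases "p = \<infinity>")
  case True
  then show ?thesis using assms by (auto simp: lp_comb_def intro!: continuous_intros)
next
  case False
  then have "0 < real_of_ereal p" using p by (cases p) (auto simp: one_ereal_def)
  then show ?thesis
    unfolding lp_comb_def if_not_P[OF False] using assms
    by (intro continuous_on_powr' continuous_on_add continuous_on_const) auto
qed

text \<open>For \<open>p = \<infinity>\<close> the unit set is a product. For finite
  \<open>p = q\<close> the slice over \<open>x\<close> is the sublevel set of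
  \<open>l powr q\<close> at \<open>1 - k x powr q\<close>, and the Beta integral applies to
  \<open>k powr q\<close>.\<close>

lemma integral_slices_lp_comb:
  fixes k :: "'a::euclidean_space \<Rightarrow> real" and l :: "'a \<Rightarrow> real"
  assumes p: "1 \<le> p" and k: "sublinear_pos k" and l: "sublinear_pos l"
  shows "(\<integral>\<^sup>+x. emeasure lborel {y. lp_comb p (k x) (l y) \<le> 1} \<partial>lborel) =
    ennreal (Gamma (1 + over_exponent (real DIM('a)) p) ^ 2 /
      Gamma (1 + over_exponent (real (2 * DIM('a))) p) *
      measure lborel {x. k x \<le> 1} * measure lborel {x. l x \<le> 1})"
proof -
  let ?n = "real DIM('a)"
  let ?A = "measure lborel {x. k x \<le> 1}" and ?B = "measure lborel {x. l x \<le> 1}"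
  note kD = sublinear_posD[OF k] and lD = sublinear_posD[OF l]
  have [measurable]: "k \<in> borel_measurable borel"
    using kD(6) by (rule borel_measurable_continuous_onI)
  consider "p = \<infinity>" | q where "p = ereal q" "q \<ge> 1"
    using p by (cases p) (auto simp: one_ereal_def)
  then show ?thesis
  proof cases
    case 1
    have "(\<integral>\<^sup>+x. emeasure lborel {y. lp_comb p (k x) (l y) \<le> 1} \<partial>lborel) =
        (\<integral>\<^sup>+x. ennreal ?B * indicator {x. k x \<le> 1} x \<partial>lborel)"
      using 1 sublinear_pos_emeasure_unit[OF l]
      by (intro nn_integral_cong) (auto simp: lp_comb_def split: split_indicator)
    also have "\<dots> = ennreal ?B * ennreal ?A"
      by (simp add: nn_integral_cmult_indicator sublinear_pos_emeasure_unit[OF k])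
    finally show ?thesis
      using 1 by (simp add: over_exponent_def ennreal_mult' mult.commute)
  next
    case 2
    \<comment> \<open>The sublevel set of \<open>h powr q\<close> at \<open>t\<close> is that of
      \<open>h\<close> at \<open>t powr (1 / q)\<close>, so its volume scales as
      \<open>t powr (n / q)\<close>.\<close>
    define a where "a = ?n / q"
    have a: "0 < a" using 2 by (simp add: a_def)
    have root: "s powr q \<le> t \<longleftrightarrow> s \<le> t powr (1 / q)" if "0 \<le> s" "0 \<le> t" for s t :: real
    proof -
      have "(s powr q) powr (1 / q) = s" "(t powr (1 / q)) powr q = t"
        using that 2 by (simp_all add: powr_powr)
      then show ?thesis
        using powr_mono2[of q s "t powr (1 / q)"] powr_mono2[of "1 / q" "s powr q" t] that 2
        by auto
    qed
    have pw: "(t powr (1 / q)) ^ DIM('a) = t powr a" if "0 \<le> t" for t :: real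
      using that by (simp add: a_def powr_powr flip: powr_realpow')
    have lev: "emeasure lborel {x. h x powr q \<le> t} = ennreal (measure lborel {x. h x \<le> 1} * t powr a)"
      if "sublinear_pos h" "0 \<le> t" for h :: "'a \<Rightarrow> real" and t
      using that by (simp add: root sublinear_posD(4) sublinear_pos_emeasure_sublevel pw)
    have "(\<integral>\<^sup>+x. emeasure lborel {y. lp_comb p (k x) (l y) \<le> 1} \<partial>lborel) =
        (\<integral>\<^sup>+x. ennreal ?B * (ennreal ((1 - k x powr q) powr a) * indicator {..1} (k x powr q)) \<partial>lborel)"
    proof (rule nn_integral_cong)
      fix x
      have "lp_comb p (k x) (l y) \<le> 1 \<longleftrightarrow> k x powr q + l y powr q \<le> 1" for y
        using powr_mono2[of "1 / q" "k x powr q + l y powr q" 1]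
          powr_less_mono2[of "1 / q" 1 "k x powr q + l y powr q"] 2
        by (cases "k x powr q + l y powr q \<le> 1") (simp_all add: lp_comb_def not_le)
      then have e: "{y. lp_comb p (k x) (l y) \<le> 1} = {y. l y powr q \<le> 1 - k x powr q}"
        by (simp only: le_diff_eq add.commute[of "l _ powr q"])
      show "emeasure lborel {y. lp_comb p (k x) (l y) \<le> 1} =
          ennreal ?B * (ennreal ((1 - k x powr q) powr a) * indicator {..1} (k x powr q))"
      proof (cases "k x powr q \<le> 1")
        case True
        then show ?thesis unfolding e by (simp add: lev[OF l] ennreal_mult')
      next
        case False
        \<comment> \<open>Here the slice is empty, in agreement with the vanishing
          indicator.\<close>
        have "\<not> l y powr q \<le> 1 - k x powr q" for y
          using False powr_ge_zero[of "l y" q] by linarith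
        then show ?thesis unfolding e using False by simp
      qed
    qed
    also have "\<dots> = ennreal ?B * (\<integral>\<^sup>+x. ennreal ((1 - k x powr q) powr a) * indicator {..1} (k x powr q) \<partial>lborel)"
      by (rule nn_integral_cmult) measurable
    also have "\<dots> = ennreal ?B * ennreal (?A * (Gamma (1 + a) ^ 2 / Gamma (1 + 2 * a)))"
      using a by (subst nn_integral_one_minus_powr[of _ _ a ?A]) (auto simp: lev[OF k])
    finally show ?thesis
      using 2 by (simp add: over_exponent_def a_def ennreal_mult'[symmetric] mult_ac)
  qed
qed

section \<open>The volume inequality for the two polar bodies\<close>

theorem theorem1p4:
  fixes K L :: "(real ^ 'n) set" and p :: ereal
  assumes "convex_body K" and "convex_body L"
    and "0 \<in> interior K" and "0 \<in> interior L"
    and "1 \<le> p"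
  shows "measure lebesgue (polar_body (lp_inter p K L)) *
           measure lebesgue (polar_body (lp_sum p K (uminus ` L)))
         \<le> real ((2 * CARD('n)) choose CARD('n)) *
           (Gamma (1 + over_exponent (real CARD('n)) p) ^ 2 /
            Gamma (1 + over_exponent (real (2 * CARD('n))) p)) *
           measure lebesgue (polar_body K) * measure lebesgue (polar_body L)"
proof -
  let ?k = "support_fun K" and ?l = "support_fun L"
  note L' = convex_body_uminus[OF assms(2,4)]
  note k = sublinear_pos_support[OF assms(1,3)] and l = sublinear_pos_support[OF assms(2,4)]
  note i = sublinear_pos_lp_inter_support[OF assms(5,1,3,2,4)]
  note s = sublinear_pos_lp_sum_support[OF assms(5,1,3) L']
  note kD = sublinear_posD[OF k] and lD = sublinear_posD[OF l]
  note C = lp_comb_basic[OF assms(5) kD(4) lD(4)]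
  interpret gauge_pair "\<lambda>x y. lp_comb p (?k x) (?l y)"
  proof
    show "continuous_on UNIV (\<lambda>(x, y). lp_comb p (?k x) (?l y))"
      unfolding case_prod_beta using kD(4,6) lD(4,6) assms(5)
      by (intro continuous_on_lp_comb continuous_on_compose2[OF kD(6)]
          continuous_on_compose2[OF lD(6)] continuous_intros) auto
    show "lp_comb p (?k (x + x')) (?l (y + y')) \<le> lp_comb p (?k x) (?l y) + lp_comb p (?k x') (?l y')"
      for x x' y y'
      by (rule order.trans[OF C(6)[OF kD(1) lD(1)] lp_comb_triangle[OF assms(5) kD(4) lD(4) kD(4) lD(4)]])
  qed (simp_all add: C kD lD)
  \<comment> \<open>The gauge of the projected unit set is the support function of the
    \<open>lp_inter\<close> body, so the projection inequality bounds its polar.\<close>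
  have q: "sum_gauge = lp_inter_support p K L"
    by (simp add: fun_eq_iff sum_gauge_def lp_inter_support_def)
  have I: "polar_body (lp_inter p K L) = {z. sum_gauge z \<le> 1}"
    using lp_inter_props[OF assms(5,1,3,2,4)] by (simp add: polar_body_eq_sublevel q)
  have S: "polar_body (lp_sum p K (uminus ` L)) = {w. lp_sum_support p K (uminus ` L) w \<le> 1}"
    using lp_sum_props[OF assms(5,1,3) L'] by (simp add: polar_body_eq_sublevel)
  \<comment> \<open>Reflecting \<open>L\<close> makes the support function of the sum equal to
    \<open>N w (- w)\<close>, so its polar is the central fibre.\<close>
  have S': "lp_sum_support p K (uminus ` L) w = lp_comb p (?k w) (?l (- w))" for w
    by (simp add: lp_sum_support_def support_fun_uminus)
  have meas: "measure lebesgue {x. h x \<le> 1} = measure lborel {x. h x \<le> 1}"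
    if "sublinear_pos h" for h :: "real ^ 'n \<Rightarrow> real"
    using sublinear_pos_closed_sublevel[OF that, of 1] by (simp add: measure_completion)
  let ?R = "real ((2 * CARD('n)) choose CARD('n)) *
           (Gamma (1 + over_exponent (real CARD('n)) p) ^ 2 /
            Gamma (1 + over_exponent (real (2 * CARD('n))) p) *
           measure lborel {x. ?k x \<le> 1} * measure lborel {x. ?l x \<le> 1})"
  \<comment> \<open>Positive Gamma arguments make the right side nonnegative, which allows the
    return from \<open>ennreal\<close> to real numbers.\<close>
  have "0 < 1 + over_exponent (real m) p" for m
    using assms(5) by (cases p) (auto simp: over_exponent_def one_ereal_def intro!: add_pos_nonneg)
  then have "0 \<le> ?R"
    by (intro mult_nonneg_nonneg divide_nonneg_pos Gamma_real_pos)
       (simp_all del: of_nat_mult)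
  moreover have "ennreal (measure lborel {z. sum_gauge z \<le> 1} *
      measure lborel {w. lp_sum_support p K (uminus ` L) w \<le> 1}) \<le> ennreal ?R"
    using rogers_shephard[unfolded q, OF i] integral_slices_lp_comb[OF assms(5) k l]
      sublinear_pos_emeasure_unit[OF i] sublinear_pos_emeasure_unit[OF s]
    by (simp add: q S' ennreal_mult' del: times_divide_eq_left times_divide_eq_right)
  ultimately have "measure lborel {z. sum_gauge z \<le> 1} *
      measure lborel {w. lp_sum_support p K (uminus ` L) w \<le> 1} \<le> ?R"
    by simp
  then show ?thesis
    using assms(1,2) by (simp add: I S meas[OF s] meas[OF i[folded q]] meas[OF k] meas[OF l]
      polar_body_eq_sublevel mult.assoc)
qed

end
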